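(* Let $C\ge 2$, let $f_{\theta_t},f_{\theta_s}:\mathbb{R}^d\to\mathbb{R}^C$ be two neural network classifiers (a fixed teacher with parameters $\theta_t$ and a student with parameters $\theta_s$), let $\mathbf{x}\in\mathbb{R}^d$ be an input with true label $y\in\{1,\dots,C\}$, let $\varepsilon\ge 0$, let $\mathbf{x_{adv}}\in\mathcal{B}_\varepsilon(\mathbf{x})$, and let $\alpha\in[0,1]$. Write $P_\theta(\cdot)=\mathrm{softmax}(f_\theta(\cdot))$ and $$\mathcal{L}_{\mathrm{AD\text{-}CERT}} := (1-\alpha)\,\mathrm{KL}\left(P_{\theta_t}(\mathbf{x})\,\|\,P_{\theta_s}(\mathbf{x_{adv}})\right)+\alpha\,\mathcal{L}_{\mathrm{IBP}},\qquad \mathcal{L}_{\mathrm{IBP}}:=\mathcal{L}_{\mathrm{CE}}\left(-\underline{\mathbf{z}}^{\Delta}_{\theta_s}(\mathbf{x},y),y\right).$$ For probability vectors $P=(p_i)_{i=1}^C$ and $Q=(q_i)_{i=1}^C$ let $$H(P)=-\sum_{i=1}^C p_i\log(p_i),\qquad H(Q,P)=-\sum_{i=1}^C q_i\log(p_i).$$ Then $$\mathcal{L}_{\mathrm{AD\text{-}CERT}}=(1-\alpha)H\left(P_{\theta_t}(\mathbf{x}),P_{\theta_s}(\mathbf{x_{adv}})\right)+\alpha\,\mathcal{L}_{\mathrm{IBP}}-(1-\alpha)H\left(P_{\theta_t}(\mathbf{x})\right).$$ Therefore, up to an additive constant independent of $\theta_s$ (namely $-(1-\alpha)H(P_{\theta_t}(\mathbf{x}))$),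 $\mathcal{L}_{\mathrm{AD\text{-}CERT}}$ is the scalarisation, with weights $1-\alpha$ and $\alpha$, of (i) the soft-label adversarial cross-entropy $H(P_{\theta_t}(\mathbf{x}),P_{\theta_s}(\mathbf{x_{adv}}))$ and (ii) the IBP upper bound loss $\mathcal{L}_{\mathrm{IBP}}$.
   Context: $\mathcal{B}_\varepsilon(\mathbf{x})=\{\mathbf{x}':\|\mathbf{x}'-\mathbf{x}\|_\infty\le\varepsilon\}$. For $v\in\mathbb{R}^C$, $[\mathrm{softmax}(v)]_i=e^{v_i}/\sum_{j=1}^C e^{v_j}$. For probability vectors $P,Q$ with positive entries, $\mathrm{KL}(P\,\|\,Q)=\sum_{i=1}^C p_i\log(p_i/q_i)$ (natural logarithm). Cross-entropy with a hard label: $\mathcal{L}_{\mathrm{CE}}(v,y)=\log\left(1+\sum_{i\ne y}\exp(v_i-v_y)\right)$ for $v\in\mathbb{R}^C$. When applied to a vector of negated logit differences $-\mathbf{z}$ with $\mathbf{z}=(z_i)_{i\neq y}\in\mathbb{R}^{C-1}$, the (missing) $y$-entry is read as $0$, so $\mathcal{L}_{\mathrm{CE}}(-\mathbf{z},y)=\log\left(1+\sum_{i\ne y}\exp(-z_i)\right)$. Interval Bound Propagation (IBP): the network is a composition of affine layers and element-wise increasing activations (e.g. ReLU). Starting from the box $[\mathbf{x}-\varepsilon,\mathbf{x}+\varepsilon]$, bounds are propagated layer by layer: for an affine layer $z\mapsto Wz+b$ with input bounds $\underline z,\overline z$, put $\mu=(\overline z+\underline z)/2$ and $r=(\overline z-\underline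 z)/2$; the output bounds are $W\mu+b\mp|W|r$ (with $|W|$ the entrywise absolute value); for an element-wise increasing activation $h$ the output bounds are $h(\underline z),h(\overline z)$. Let $\underline{[f_\theta]}_i$ and $\overline{[f_\theta]}_i$ denote the resulting lower and upper bounds of the $i$-th output coordinate over $\mathcal{B}_\varepsilon(\mathbf{x})$. Then $\underline{\mathbf{z}}^{\Delta}_{\theta}(\mathbf{x},y):=\left(\underline{[f_\theta]}_y-\overline{[f_\theta]}_i\right)_{i\ne y}$. The teacher parameters $\theta_t$ are fixed and do not depend on $\theta_s$. *)

theory Defs
  imports Complex_Main "Jordan_Normal_Form.Matrix"
begin

text \<open>Vectors of \<open>\<real>\<^sup>n\<close> are elements of \<^term>\<open>carrier_vec n :: real vec set\<close>; coordinates and class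
  labels are indexed from \<open>0\<close>, so the labels are \<open>0, \<dots>, C - 1\<close>.\<close>

datatype layer =
    Affine "real mat" "real vec"
  | Activation "real \<Rightarrow> real"

type_synonym network = "layer list"

text \<open>Layers are listed from the input to the output. The hidden dimensions are not fixed; they are
  determined by the weight matrices.\<close>

fun is_network :: "nat \<Rightarrow> nat \<Rightarrow> network \<Rightarrow> bool" where
  "is_network n m [] \<longleftrightarrow> n = m"
| "is_network n m (Affine W b # ls) \<longleftrightarrow>
     dim_col W = n \<and> dim_vec b = dim_row W \<and> is_network (dim_row W) m ls"
| "is_network n m (Activation h # ls) \<longleftrightarrow> mono h \<and> is_network n m ls"

fun layer_eval :: "layer \<Rightarrow> real vec \<Rightarrow> real vec" where
  "layer_eval (Affine W b) z = W *\<^sub>v z + b"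
| "layer_eval (Activation h) z = map_vec h z"

definition net_eval :: "network \<Rightarrow> real vec \<Rightarrow> real vec" where
  "net_eval ls z = fold layer_eval ls z"

fun layer_ibp :: "layer \<Rightarrow> real vec \<times> real vec \<Rightarrow> real vec \<times> real vec" where
  "layer_ibp (Affine W b) (l, u) =
     (let \<mu> = (1 / 2) \<cdot>\<^sub>v (u + l); r = (1 / 2) \<cdot>\<^sub>v (u - l)
      in (W *\<^sub>v \<mu> + b - map_mat abs W *\<^sub>v r, W *\<^sub>v \<mu> + b + map_mat abs W *\<^sub>v r))"
| "layer_ibp (Activation h) (l, u) = (map_vec h l, map_vec h u)"

definition ibp_bounds :: "network \<Rightarrow> real \<Rightarrow> real vec \<Rightarrow> real vec \<times> real vec" where
  "ibp_bounds ls \<epsilon> x = fold layer_ibp ls (map_vec (\<lambda>t. t - \<epsilon>) x, map_vec (\<lambda>t. t + \<epsilon>) x)"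

definition ibp_lower :: "network \<Rightarrow> real \<Rightarrow> real vec \<Rightarrow> real vec" where
  "ibp_lower ls \<epsilon> x = fst (ibp_bounds ls \<epsilon> x)"

definition ibp_upper :: "network \<Rightarrow> real \<Rightarrow> real vec \<Rightarrow> real vec" where
  "ibp_upper ls \<epsilon> x = snd (ibp_bounds ls \<epsilon> x)"

text \<open>The vector of lower bounds on the logit differences only has entries for \<open>i \<noteq> y\<close>. It is stored
  with the missing \<open>y\<close>-entry set to \<open>0\<close>, which is how the cross-entropy is to read it. The generic
  formula would put the possibly nonzero lower minus upper bound of the logit \<open>y\<close> there.\<close>

definition ibp_logit_diff :: "network \<Rightarrow> real \<Rightarrow> real vec \<Rightarrow> nat \<Rightarrow> real vec" where
  "ibp_logit_diff ls \<epsilon> x y =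
     vec (dim_vec (ibp_lower ls \<epsilon> x))
       (\<lambda>i. if i = y then 0 else ibp_lower ls \<epsilon> x $ y - ibp_upper ls \<epsilon> x $ i)"

text \<open>The inserted \<open>0\<close> only matters for the empty vector.\<close>

definition linf_norm :: "real vec \<Rightarrow> real" where
  "linf_norm v = Max (insert 0 ((\<lambda>i. \<bar>v $ i\<bar>) ` {..<dim_vec v}))"

definition linf_ball :: "real \<Rightarrow> real vec \<Rightarrow> real vec set" where
  "linf_ball \<epsilon> x = {x' \<in> carrier_vec (dim_vec x). linf_norm (x' - x) \<le> \<epsilon>}"

definition softmax :: "real vec \<Rightarrow> real vec" where
  "softmax v = vec (dim_vec v) (\<lambda>i. exp (v $ i) / (\<Sum>j<dim_vec v. exp (v $ j)))"

definition KL :: "real vec \<Rightarrow> real vec \<Rightarrow> real" where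
  "KL P Q = (\<Sum>i<dim_vec P. P $ i * ln (P $ i / Q $ i))"

definition entropy :: "real vec \<Rightarrow> real" where
  "entropy P = - (\<Sum>i<dim_vec P. P $ i * ln (P $ i))"

definition cross_entropy :: "real vec \<Rightarrow> real vec \<Rightarrow> real" where
  "cross_entropy Q P = - (\<Sum>i<dim_vec Q. Q $ i * ln (P $ i))"

definition CE_loss :: "real vec \<Rightarrow> nat \<Rightarrow> real" where
  "CE_loss v y = ln (1 + (\<Sum>i\<in>{..<dim_vec v} - {y}. exp (v $ i - v $ y)))"

definition IBP_loss :: "network \<Rightarrow> real \<Rightarrow> real vec \<Rightarrow> nat \<Rightarrow> real" where
  "IBP_loss ls \<epsilon> x y = CE_loss (- ibp_logit_diff ls \<epsilon> x y) y"

definition AD_CERT_loss ::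
  "real \<Rightarrow> network \<Rightarrow> network \<Rightarrow> real \<Rightarrow> real vec \<Rightarrow> real vec \<Rightarrow> nat \<Rightarrow> real" where
  "AD_CERT_loss \<alpha> teacher student \<epsilon> x x_adv y =
     (1 - \<alpha>) * KL (softmax (net_eval teacher x)) (softmax (net_eval student x_adv))
     + \<alpha> * IBP_loss student \<epsilon> x y"

definition scalarisation :: "real \<Rightarrow> ('p \<Rightarrow> real) \<Rightarrow> real \<Rightarrow> ('p \<Rightarrow> real) \<Rightarrow> 'p \<Rightarrow> real" where
  "scalarisation w\<^sub>1 L\<^sub>1 w\<^sub>2 L\<^sub>2 = (\<lambda>\<theta>. w\<^sub>1 * L\<^sub>1 \<theta> + w\<^sub>2 * L\<^sub>2 \<theta>)"

definition equal_up_to_constant :: "'p set \<Rightarrow> real \<Rightarrow> ('p \<Rightarrow> real) \<Rightarrow> ('p \<Rightarrow> real) \<Rightarrow> bool" where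
  "equal_up_to_constant \<Theta> c F G \<longleftrightarrow> (\<forall>\<theta>\<in>\<Theta>. F \<theta> = G \<theta> + c)"

end

theory Submission
  imports Defs
begin

text \<open>Since ln (p / q) = ln p - ln q for positive p and q, the divergence splits as KL(P || Q)
  = H(P, Q) - H(P), which is \<open>KL_eq_cross_entropy_minus_entropy\<close>. Softmax vectors have
  positive entries (\<open>softmax_pos\<close>), so this applies to teacher and student. Scaling by
  \<open>1 - \<alpha>\<close> and adding the same IBP term to both sides gives the formula; the
  entropy left over involves the teacher alone, hence is constant in the student parameters.\<close>

lemma dim_net_eval:
  assumes "is_network n m ls" and "dim_vec z = n"
  shows "dim_vec (net_eval ls z) = m"
  using assms unfolding net_eval_def
  by (induction n m ls arbitrary: z rule: is_network.induct) auto

lemma dim_softmax [simp]: "dim_vec (softmax v) = dim_vec v"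
  by (simp add: softmax_def)

text \<open>The index \<open>i\<close> makes the normalising sum nonempty, so it is positive, being
  a sum of exponentials.\<close>

lemma softmax_pos:
  assumes "i < dim_vec v"
  shows "softmax v $ i > 0"
proof -
  have "(\<Sum>j<dim_vec v. exp (v $ j)) > 0"
    using assms by (intro sum_pos) auto
  then show ?thesis
    using assms by (simp add: softmax_def)
qed

lemma KL_eq_cross_entropy_minus_entropy:
  assumes "\<And>i. i < dim_vec P \<Longrightarrow> P $ i > 0"
    and "\<And>i. i < dim_vec P \<Longrightarrow> Q $ i > 0"
  shows "KL P Q = cross_entropy P Q - entropy P"
proof -
  have "KL P Q = (\<Sum>i<dim_vec P. P $ i * ln (P $ i) - P $ i * ln (Q $ i))"
    unfolding KL_def
    by (intro sum.cong refl) (simp add: assms ln_divide_pos right_diff_distrib)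
  then show ?thesis
    by (simp add: cross_entropy_def entropy_def sum_subtractf)
qed

text \<open>\<open>x_adv\<close> is a function of the student parameters because an attack may
  depend on the student; the constant is nevertheless fixed before \<theta> ranges over
  \<Theta>.\<close>

theorem proposition3p2:
  fixes C d y :: nat
    and f\<^sub>t :: "'q \<Rightarrow> network" and \<theta>\<^sub>t :: 'q
    and f\<^sub>s :: "'p \<Rightarrow> network" and \<Theta> :: "'p set"
    and x :: "real vec" and x_adv :: "'p \<Rightarrow> real vec"
    and \<epsilon> \<alpha> :: real
  assumes "C \<ge> 2"
    and "is_network d C (f\<^sub>t \<theta>\<^sub>t)"
    and "\<And>\<theta>\<^sub>s. \<theta>\<^sub>s \<in> \<Theta> \<Longrightarrow> is_network d C (f\<^sub>s \<theta>\<^sub>s)"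
    and "x \<in> carrier_vec d"
    and "y < C"
    and "\<epsilon> \<ge> 0"
    and "\<And>\<theta>\<^sub>s. \<theta>\<^sub>s \<in> \<Theta> \<Longrightarrow> x_adv \<theta>\<^sub>s \<in> linf_ball \<epsilon> x"
    and "\<alpha> \<in> {0..1}"
  shows "(\<forall>\<theta>\<^sub>s\<in>\<Theta>.
            AD_CERT_loss \<alpha> (f\<^sub>t \<theta>\<^sub>t) (f\<^sub>s \<theta>\<^sub>s) \<epsilon> x (x_adv \<theta>\<^sub>s) y =
              (1 - \<alpha>) * cross_entropy (softmax (net_eval (f\<^sub>t \<theta>\<^sub>t) x))
                                       (softmax (net_eval (f\<^sub>s \<theta>\<^sub>s) (x_adv \<theta>\<^sub>s)))
              + \<alpha> * IBP_loss (f\<^sub>s \<theta>\<^sub>s) \<epsilon> x y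
              - (1 - \<alpha>) * entropy (softmax (net_eval (f\<^sub>t \<theta>\<^sub>t) x)))
       \<and> equal_up_to_constant \<Theta> (- (1 - \<alpha>) * entropy (softmax (net_eval (f\<^sub>t \<theta>\<^sub>t) x)))
           (\<lambda>\<theta>\<^sub>s. AD_CERT_loss \<alpha> (f\<^sub>t \<theta>\<^sub>t) (f\<^sub>s \<theta>\<^sub>s) \<epsilon> x (x_adv \<theta>\<^sub>s) y)
           (scalarisation
              (1 - \<alpha>) (\<lambda>\<theta>\<^sub>s. cross_entropy (softmax (net_eval (f\<^sub>t \<theta>\<^sub>t) x))
                                            (softmax (net_eval (f\<^sub>s \<theta>\<^sub>s) (x_adv \<theta>\<^sub>s))))
              \<alpha> (\<lambda>\<theta>\<^sub>s. IBP_loss (f\<^sub>s \<theta>\<^sub>s) \<epsilon> x y))"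
proof -
  let ?P = "softmax (net_eval (f\<^sub>t \<theta>\<^sub>t) x)"
  let ?Q = "\<lambda>\<theta>\<^sub>s. softmax (net_eval (f\<^sub>s \<theta>\<^sub>s) (x_adv \<theta>\<^sub>s))"
  have "KL ?P (?Q \<theta>\<^sub>s) = cross_entropy ?P (?Q \<theta>\<^sub>s) - entropy ?P" if "\<theta>\<^sub>s \<in> \<Theta>" for \<theta>\<^sub>s
  proof -
    \<comment> \<open>Positivity of the student's entries is needed at every index of the teacher's
      vector, so the two outputs must have the same length.\<close>
    have "dim_vec (net_eval (f\<^sub>t \<theta>\<^sub>t) x) = C"
      using assms(2,4) by (simp add: dim_net_eval)
    moreover have "dim_vec (net_eval (f\<^sub>s \<theta>\<^sub>s) (x_adv \<theta>\<^sub>s)) = C"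
      \<comment> \<open>Membership in the ball also fixes the dimension of the perturbed
        input.\<close>
      using assms(3,7)[OF that] assms(4) by (simp add: dim_net_eval linf_ball_def)
    ultimately show ?thesis
      by (intro KL_eq_cross_entropy_minus_entropy) (simp_all add: softmax_pos)
  qed
  then show ?thesis
    \<comment> \<open>The flipped rule moves minus signs into the coefficient of the entropy, the
      form the constant has in the claim.\<close>
    by (simp add: AD_CERT_loss_def equal_up_to_constant_def scalarisation_def right_diff_distrib
        flip: mult_minus_left)
qed

end
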